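(* The effective entropy of the query $\mathrm{R2M}$ (and hence also of $\mathrm{RT2Q}$) over arrays $A[1..n]$ is at least $2.638n-O(\log n)$ bits.
   Context: For an array $A[1..n]$ of distinct elements from a totally ordered set and $1\le i<j\le n$, $\mathrm{R2M}(i,j)$ is the index of the second smallest element of $A[i..j]$, and $\mathrm{RT2Q}(i,j)$ is the pair consisting of the index of the smallest and the index of the second smallest element of $A[i..j]$. The effective entropy of a set $Q$ of queries over arrays of length $n$ is $\lceil\log_2|\mathcal C|\rceil$, where $\mathcal C$ is the set of equivalence classes of such arrays under the relation "two arrays give the same answer to every query in $Q$" (here $Q$ is the set of all queries $\mathrm{R2M}(i,j)$, resp. $\mathrm{RT2Q}(i,j)$, with $1\le i<j\le n$). *)

theory Defs
  imports Complex_Main "HOL-Library.FuncSet" "HOL-Library.Landau_Symbols"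
begin

(* Arrays are 1-based; extensionality makes the value outside {1..n} irrelevant. *)
definition arrays :: "'a::linorder set \<Rightarrow> nat \<Rightarrow> (nat \<Rightarrow> 'a) set" where
  "arrays U n = {A \<in> {1..n} \<rightarrow>\<^sub>E U. inj_on A {1..n}}"

definition RMQ :: "(nat \<Rightarrow> 'a::linorder) \<Rightarrow> nat \<Rightarrow> nat \<Rightarrow> nat" where
  "RMQ A i j = arg_min_on A {i..j}"

definition R2M :: "(nat \<Rightarrow> 'a::linorder) \<Rightarrow> nat \<Rightarrow> nat \<Rightarrow> nat" where
  "R2M A i j = arg_min_on A ({i..j} - {RMQ A i j})"

definition RT2Q :: "(nat \<Rightarrow> 'a::linorder) \<Rightarrow> nat \<Rightarrow> nat \<Rightarrow> nat \<times> nat" where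
  "RT2Q A i j = (RMQ A i j, R2M A i j)"

(* A single query is a function from arrays to answers. *)
definition range_queries :: "('b \<Rightarrow> nat \<Rightarrow> nat \<Rightarrow> 'r) \<Rightarrow> nat \<Rightarrow> ('b \<Rightarrow> 'r) set" where
  "range_queries q n = {\<lambda>A. q A i j | i j. 1 \<le> i \<and> i < j \<and> j \<le> n}"

definition query_equiv :: "'b set \<Rightarrow> ('b \<Rightarrow> 'r) set \<Rightarrow> 'b rel" where
  "query_equiv X Q = {(A, B). A \<in> X \<and> B \<in> X \<and> (\<forall>q\<in>Q. q A = q B)}"

definition effective_entropy :: "'b set \<Rightarrow> ('b \<Rightarrow> 'r) set \<Rightarrow> int" where
  "effective_entropy X Q = \<lceil>log 2 (real (card (X // query_equiv X Q)))\<rceil>"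

end

theory Submission
  imports Defs
begin

text \<open>
  Call a position of \<open>A[1..n]\<close> a suffix minimum if no later element is smaller, and a suffix
  second minimum if exactly one later element is smaller; let \<open>q\<close> and \<open>a\<close> be their numbers, and
  \<open>w = a + 2 q\<close>. The \<open>R2M\<close> answers determine all \<open>RMQ\<close> answers, hence \<open>q\<close> and \<open>a\<close>.
  Appending an element with rank \<open>r\<close> among these \<open>q + a\<close> elements gives an array of weight
  \<open>q + 2 + r\<close>, so an equivalence class of weight \<open>w\<close> has extensions of every weight in
  \<open>{q + 2..w + 2}\<close>, necessarily in distinct classes.

  A solution of \<open>f (k + 3) = \<mu> (f (k + 1) - f k)\<close> satisfies
  \<open>f (q + 2) + \<dots> + f (w + 2) = \<mu> (f w - f (q - 1))\<close>. For \<open>\<mu>\<close> below \<open>27/4\<close> there is a solution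
  \<open>f k = - \<rho> ^ k * sin (k \<pi> / L)\<close>: it is nonpositive on \<open>{0..L}\<close> and positive strictly between
  \<open>L\<close> and \<open>2 L\<close>. Since \<open>2 q \<le> w\<close>, the subtracted term is harmless whenever \<open>w < 2 L\<close>, and
  the sum of the truncation of \<open>f\<close> over all classes grows at least by the factor \<open>\<mu>\<close> with each
  appended element. For \<open>L = 100\<close> one has \<open>\<mu> \<ge> 2 powr (8/3)\<close>, and \<open>8/3 > 2.638\<close>.
\<close>

section \<open>Ranks in finite linear orders\<close>

text \<open>\<open>s\<close> need not lie in \<open>S\<close>: for a new value, its rank names the
  gap of \<open>S\<close> into which it falls.\<close>

definition rank :: "'a::linorder set \<Rightarrow> 'a \<Rightarrow> nat" where
  "rank S s = card {t \<in> S. t < s}"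

lemma rank_less_iff:
  assumes "finite S" "s \<in> S" "t \<in> S"
  shows "rank S s < rank S t \<longleftrightarrow> s < t"
proof -
  have mono: "rank S a < rank S b" if "a \<in> S" "a < b" for a b
    unfolding rank_def using assms(1) that by (intro psubset_card_mono) auto
  show ?thesis
    using mono[of s t] mono[of t s] assms by (cases s t rule: linorder_cases) auto
qed

lemma bij_betw_rank:
  assumes "finite S"
  shows "bij_betw (rank S) S {..<card S}"
proof -
  have inj: "inj_on (rank S) S"
    by (rule inj_onI) (metis assms less_irrefl linorder_neqE rank_less_iff)
  have "rank S ` S \<subseteq> {..<card S}"
    unfolding rank_def using assms by (auto intro!: psubset_card_mono)
  then have "rank S ` S = {..<card S}"
    using inj by (intro card_subset_eq) (auto simp: card_image)
  with inj show ?thesis by (simp add: bij_betw_def)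
qed

text \<open>By density there is room in every gap of \<open>S\<close> as well as below and above
  \<open>S\<close>, and a finite \<open>T\<close> cannot fill it. In the application
  \<open>T\<close> holds all values already present, so that the new one is distinct from
  them.\<close>

lemma ex_real_of_rank:
  fixes S T :: "real set"
  assumes "finite S" "finite T" "r \<le> card S"
  shows "\<exists>x. x \<notin> T \<and> rank S x = r"
proof (cases "r = card S")
  case True
  obtain x where x: "\<And>t. t \<in> S \<union> T \<Longrightarrow> t < x"
    using assms by (metis finite_Un bdd_above_finite bdd_above_def gt_ex le_less_trans)
  then have "{t \<in> S. t < x} = S" by auto
  with x True show ?thesis unfolding rank_def by (intro exI[of _ x]) auto
next
  case False
  then have "r \<in> rank S ` S"
    using assms bij_betw_rank[OF assms(1)] by (auto simp: bij_betw_def)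
  then obtain s where s: "s \<in> S" "r = rank S s" by auto
  \<comment> \<open>The element \<open>s - 1\<close> keeps \<open>M\<close> nonempty when nothing in
    \<open>S\<close> or \<open>T\<close> lies below \<open>s\<close>.\<close>
  define M where "M = insert (s - 1) {t \<in> S \<union> T. t < s}"
  have M: "finite M" "M \<noteq> {}" using assms by (auto simp: M_def)
  then have "Max M < s" by (auto simp: M_def)
  then obtain x where x: "Max M < x" "x < s" using dense by blast
  have lt: "t < x" if "t \<in> S \<union> T" "t < s" for t
    using Max_ge[of M t] M x that by (auto simp: M_def)
  have "{t \<in> S. t < x} = {t \<in> S. t < s}" using lt x by auto
  moreover have "x \<notin> T" using lt x by auto
  ultimately show ?thesis using s unfolding rank_def by auto
qed

text \<open>Queries see only the order of the entries. Replacing each entry by the element of equal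
  rank in an \<open>n\<close>-element \<open>V\<close> carries answer tables over the reals, where
  values can be inserted freely, to any sufficiently large \<open>U\<close>.\<close>

lemma ex_order_isomorphic_array:
  fixes A :: "nat \<Rightarrow> 'b::linorder" and U :: "'a::linorder set"
  assumes A: "inj_on A {1..n}" and U: "infinite U \<or> n \<le> card U"
  shows "\<exists>B \<in> arrays U n. \<forall>i\<in>{1..n}. \<forall>j\<in>{1..n}. B i < B j \<longleftrightarrow> A i < A j"
proof -
  obtain V where V: "V \<subseteq> U" "card V = n" "finite V"
    using U by (metis infinite_arbitrarily_large obtain_subset_with_card_n)
  let ?R = "A ` {1..n}"
  have cR: "card ?R = n" using A by (simp add: card_image)
  have bR: "bij_betw (rank ?R) ?R {..<n}" using bij_betw_rank[of ?R] cR by simp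
  have bV: "bij_betw (rank V) V {..<n}" using bij_betw_rank[of V] V by simp
  define B where "B = (\<lambda>i\<in>{1..n}. inv_into V (rank V) (rank ?R (A i)))"
  have B: "B i \<in> V \<and> rank V (B i) = rank ?R (A i)" if "i \<in> {1..n}" for i
  proof -
    have "rank ?R (A i) \<in> rank V ` V" using bR bV that by (auto simp: bij_betw_def)
    then show ?thesis using that by (auto simp: B_def inv_into_into f_inv_into_f)
  qed
  have iff: "B i < B j \<longleftrightarrow> A i < A j" if "i \<in> {1..n}" "j \<in> {1..n}" for i j
    using rank_less_iff[of V "B i" "B j"] rank_less_iff[of ?R "A i" "A j"] B that V by auto
  have "inj_on B {1..n}"
  proof (rule inj_onI)
    fix i j assume ij: "i \<in> {1..n}" "j \<in> {1..n}" "B i = B j"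
    then have "A i = A j" using iff by (metis less_irrefl linorder_neqE)
    with A ij show "i = j" by (auto dest: inj_onD)
  qed
  moreover have "B \<in> {1..n} \<rightarrow>\<^sub>E U" using B V(1) by (auto simp: B_def)
  ultimately show ?thesis using iff unfolding arrays_def by blast
qed

section \<open>Range minimum and second minimum queries\<close>

lemma arg_min_on_eq_iff:
  fixes A :: "'b \<Rightarrow> 'a::linorder"
  assumes "finite S" "inj_on A S" "x \<in> S"
  shows "arg_min_on A S = x \<longleftrightarrow> (\<forall>y\<in>S. y \<noteq> x \<longrightarrow> A x < A y)"
proof -
  have S: "S \<noteq> {}" using assms by auto
  have m: "arg_min_on A S \<in> S" "\<And>y. y \<in> S \<Longrightarrow> A (arg_min_on A S) \<le> A y"
    using arg_min_if_finite(1)[OF assms(1) S] arg_min_least[OF assms(1) S] by auto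
  show ?thesis
  proof
    assume "arg_min_on A S = x"
    then show "\<forall>y\<in>S. y \<noteq> x \<longrightarrow> A x < A y"
      using m assms by (metis inj_onD order_le_less)
  next
    assume "\<forall>y\<in>S. y \<noteq> x \<longrightarrow> A x < A y"
    then show "arg_min_on A S = x" using m assms by (meson leD)
  qed
qed

lemma arg_min_on_cong_order:
  fixes A :: "'b \<Rightarrow> 'a::linorder" and B :: "'b \<Rightarrow> 'c::linorder"
  assumes "finite S" "inj_on A S" "inj_on B S" "S \<noteq> {}"
    and "\<And>i j. i \<in> S \<Longrightarrow> j \<in> S \<Longrightarrow> A i < A j \<longleftrightarrow> B i < B j"
  shows "arg_min_on A S = arg_min_on B S"
proof -
  have m: "arg_min_on B S \<in> S" using arg_min_if_finite(1) assms by blast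
  then show ?thesis
    using arg_min_on_eq_iff[OF assms(1,2) m] arg_min_on_eq_iff[OF assms(1,3) m] assms(5) by auto
qed

lemma RMQ_in:
  fixes A :: "nat \<Rightarrow> 'a::linorder"
  assumes "i \<le> j"
  shows "RMQ A i j \<in> {i..j}"
  using arg_min_if_finite(1)[of "{i..j}" A] assms by (simp add: RMQ_def)

lemma interval_minus_RMQ_nonempty:
  fixes A :: "nat \<Rightarrow> 'a::linorder"
  assumes "i < j"
  shows "{i..j} - {RMQ A i j} \<noteq> {}"
proof -
  have "{i, j} \<subseteq> {i..j}" "i \<noteq> j" using assms by auto
  then show ?thesis by (cases "RMQ A i j = i") auto
qed

lemma R2M_in:
  fixes A :: "nat \<Rightarrow> 'a::linorder"
  assumes "i < j"
  shows "R2M A i j \<in> {i..j} - {RMQ A i j}"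
  unfolding R2M_def using interval_minus_RMQ_nonempty[OF assms]
  by (rule arg_min_if_finite(1)[rotated]) simp

lemma RMQ_eq_iff:
  fixes A :: "nat \<Rightarrow> 'a::linorder"
  assumes "inj_on A {i..j}" "x \<in> {i..j}"
  shows "RMQ A i j = x \<longleftrightarrow> (\<forall>y\<in>{i..j}. y \<noteq> x \<longrightarrow> A x < A y)"
  unfolding RMQ_def using assms by (intro arg_min_on_eq_iff) simp_all

lemma R2M_cong_order:
  fixes A :: "nat \<Rightarrow> 'a::linorder" and B :: "nat \<Rightarrow> 'c::linorder"
  assumes "i < j" "inj_on A {i..j}" "inj_on B {i..j}"
    and ord: "\<And>k l. k \<in> {i..j} \<Longrightarrow> l \<in> {i..j} \<Longrightarrow> A k < A l \<longleftrightarrow> B k < B l"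
  shows "R2M A i j = R2M B i j"
proof -
  have eq: "RMQ A i j = RMQ B i j"
    unfolding RMQ_def using assms by (intro arg_min_on_cong_order) auto
  show ?thesis
    unfolding R2M_def eq using assms(2,3) ord interval_minus_RMQ_nonempty[OF assms(1), of B]
    by (intro arg_min_on_cong_order) (simp_all add: inj_on_diff)
qed

text \<open>An interior minimum survives in both shortened intervals. A minimum at an end survives
  in only one, and the other then has the second minimum as its minimum; so the \<open>R2M\<close>
  answer tells which of two different candidates to discard.\<close>

lemma RMQ_rec:
  fixes A :: "nat \<Rightarrow> 'a::linorder"
  assumes "i < j" "inj_on A {i..j}"
  shows "RMQ A i j =
    (if RMQ A i (j - 1) = RMQ A (Suc i) j then RMQ A i (j - 1)
     else if R2M A i j = RMQ A i (j - 1) then RMQ A (Suc i) j else RMQ A i (j - 1))"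
proof -
  define m where "m = RMQ A i j"
  have m: "m \<in> {i..j}" using RMQ_in[of i j A] assms(1) by (simp add: m_def)
  have min: "A m < A y" if "y \<in> {i..j}" "y \<noteq> m" for y
    using RMQ_eq_iff[OF assms(2) m] that by (simp add: m_def)
  have inj: "inj_on A {i..j - 1}" "inj_on A {Suc i..j}"
    using assms(2) by (auto simp: inj_on_def)
  have left: "RMQ A i (j - 1) = m" if "m \<noteq> j"
    using that m min by (subst RMQ_eq_iff[OF inj(1)]) auto
  have right: "RMQ A (Suc i) j = m" if "m \<noteq> i"
    using that m min by (subst RMQ_eq_iff[OF inj(2)]) auto
  consider "m = i" | "m = j" | "m \<noteq> i" "m \<noteq> j" by blast
  then show ?thesis
  proof cases
    case 1
    have "{i..j} - {i} = {Suc i..j}" by auto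
    then have "R2M A i j = RMQ A (Suc i) j" by (simp add: R2M_def RMQ_def 1[unfolded m_def RMQ_def])
    moreover have "RMQ A (Suc i) j \<noteq> i" using RMQ_in[of "Suc i" j A] assms by auto
    ultimately show ?thesis using 1 left assms by (simp add: m_def)
  next
    case 2
    have "{i..j} - {j} = {i..j - 1}" using assms by auto
    then have "R2M A i j = RMQ A i (j - 1)" by (simp add: R2M_def RMQ_def 2[unfolded m_def RMQ_def])
    then show ?thesis using 2 right assms by (simp add: m_def)
  next
    case 3
    then show ?thesis using left right by (simp add: m_def)
  qed
qed

text \<open>Induction on the length, from singletons upwards: \<open>RMQ_rec\<close> computes each
  answer from the \<open>R2M\<close> answer and two shorter intervals.\<close>

lemma R2M_determines_RMQ:
  fixes A :: "nat \<Rightarrow> 'a::linorder" and B :: "nat \<Rightarrow> 'b::linorder"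
  assumes "i \<le> j" "inj_on A {i..j}" "inj_on B {i..j}"
    and "\<And>k l. i \<le> k \<Longrightarrow> k < l \<Longrightarrow> l \<le> j \<Longrightarrow> R2M A k l = R2M B k l"
  shows "RMQ A i j = RMQ B i j"
  using assms
proof (induction "j - i" arbitrary: i j rule: less_induct)
  case less
  show ?case
  proof (cases "i = j")
    case True
    then show ?thesis using RMQ_in[of i j A] RMQ_in[of i j B] by simp
  next
    case False
    then have ij: "i < j" using less by simp
    have "RMQ A i (j - 1) = RMQ B i (j - 1)"
      using ij less.prems by (intro less.hyps) (auto simp: inj_on_def)
    moreover have "RMQ A (Suc i) j = RMQ B (Suc i) j"
      using ij less.prems by (intro less.hyps) (auto simp: inj_on_def)
    moreover have "R2M A i j = R2M B i j" using ij less.prems by simp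
    ultimately show ?thesis using RMQ_rec[OF ij less.prems(2)] RMQ_rec[OF ij less.prems(3)] by simp
  qed
qed

section \<open>Answer tables\<close>

text \<open>A table stands for an equivalence class. Tables do not mention the element type, so
  classes over different universes can be compared, and deleting the last entries of an array is
  restriction of its table.\<close>

definition answers :: "('b \<Rightarrow> nat \<Rightarrow> nat \<Rightarrow> 'r) \<Rightarrow> nat \<Rightarrow> 'b \<Rightarrow> nat \<times> nat \<Rightarrow> 'r" where
  "answers q n A = (\<lambda>(i, j)\<in>{(i, j). 1 \<le> i \<and> i < j \<and> j \<le> n}. q A i j)"

lemma answers_eq_iff:
  "answers q n A = answers q' n B \<longleftrightarrow>
    (\<forall>i j. 1 \<le> i \<and> i < j \<and> j \<le> n \<longrightarrow> q A i j = q' B i j)"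
  by (auto simp: answers_def fun_eq_iff restrict_def)

lemma answers_restrict:
  "m \<le> n \<Longrightarrow> restrict (answers q n A) {(i, j). 1 \<le> i \<and> i < j \<and> j \<le> m} = answers q m A"
  by (auto simp: answers_def fun_eq_iff restrict_def)

lemma finite_answers:
  assumes "\<And>A i j. 1 \<le> i \<Longrightarrow> i < j \<Longrightarrow> j \<le> n \<Longrightarrow> q A i j \<in> R" "finite R"
  shows "finite (answers q n ` X)"
proof -
  let ?D = "{(i, j). 1 \<le> i \<and> i < j \<and> j \<le> n}"
  have "?D \<subseteq> {1..n} \<times> {1..n}" by auto
  then have "finite ?D" by (rule finite_subset) simp
  then have "finite (?D \<rightarrow>\<^sub>E R)" using assms(2) by (intro finite_PiE) auto
  moreover have "answers q n ` X \<subseteq> ?D \<rightarrow>\<^sub>E R"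
    unfolding answers_def using assms(1) by (intro image_subsetI restrict_PiE_iff[THEN iffD2]) auto
  ultimately show ?thesis by (rule finite_subset[rotated])
qed

lemma finite_answers_R2M: "finite (answers R2M n ` (X :: (nat \<Rightarrow> 'a::linorder) set))"
proof (rule finite_answers)
  show "R2M A i j \<in> {1..n}" if "1 \<le> i" "i < j" "j \<le> n" for A :: "nat \<Rightarrow> 'a" and i j
    using R2M_in[of i j A] that by auto
qed simp

lemma finite_answers_RT2Q: "finite (answers RT2Q n ` (X :: (nat \<Rightarrow> 'a::linorder) set))"
proof (rule finite_answers)
  show "RT2Q A i j \<in> {1..n} \<times> {1..n}" if "1 \<le> i" "i < j" "j \<le> n" for A :: "nat \<Rightarrow> 'a" and i j
    using R2M_in[of i j A] RMQ_in[of i j A] that by (auto simp: RT2Q_def)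
qed simp

text \<open>The classes are the fibres of \<open>answers q n\<close> on \<open>X\<close>; fibres of
  distinct attained tables are nonempty and disjoint, hence distinct.\<close>

lemma card_quotient_query_equiv:
  "card (X // query_equiv X (range_queries q n)) = card (answers q n ` X)"
proof -
  let ?c = "\<lambda>k. {A \<in> X. answers q n A = k}"
  have "query_equiv X (range_queries q n) `` {A} = ?c (answers q n A)" if "A \<in> X" for A
  proof -
    have "range_queries q n = (\<lambda>(i, j) C. q C i j) ` {(i, j). 1 \<le> i \<and> i < j \<and> j \<le> n}"
      by (force simp: range_queries_def)
    then have "(\<forall>f\<in>range_queries q n. f A = f B) \<longleftrightarrow> answers q n A = answers q n B" for B
      by (simp add: answers_eq_iff split_beta)
    then show ?thesis using that by (auto simp: query_equiv_def)
  qed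
  then have "X // query_equiv X (range_queries q n) = ?c ` (answers q n ` X)"
    unfolding quotient_def image_image by auto
  moreover have "inj_on ?c (answers q n ` X)"
    by (rule inj_onI) blast
  ultimately show ?thesis by (simp add: card_image)
qed

lemma card_answers_R2M_le_RT2Q:
  fixes X :: "(nat \<Rightarrow> 'a::linorder) set"
  shows "card (answers R2M n ` X) \<le> card (answers RT2Q n ` X)"
proof (rule surj_card_le)
  let ?D = "{(i, j). 1 \<le> i \<and> i < j \<and> j \<le> n}"
  have "answers R2M n A = restrict (snd \<circ> answers RT2Q n A) ?D" for A :: "nat \<Rightarrow> 'a"
    by (auto simp: answers_def fun_eq_iff restrict_def RT2Q_def)
  then show "answers R2M n ` X \<subseteq> (\<lambda>k. restrict (snd \<circ> k) ?D) ` answers RT2Q n ` X" by auto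
qed (rule finite_answers_RT2Q)

section \<open>Appending an element\<close>

definition smaller_right :: "(nat \<Rightarrow> 'a::linorder) \<Rightarrow> nat \<Rightarrow> nat \<Rightarrow> nat set" where
  "smaller_right A n z = {k \<in> {z<..n}. A k < A z}"

definition suffix_minima :: "(nat \<Rightarrow> 'a::linorder) \<Rightarrow> nat \<Rightarrow> nat set" where
  "suffix_minima A n = {z \<in> {1..n}. card (smaller_right A n z) = 0}"

definition suffix_second_minima :: "(nat \<Rightarrow> 'a::linorder) \<Rightarrow> nat \<Rightarrow> nat set" where
  "suffix_second_minima A n = {z \<in> {1..n}. card (smaller_right A n z) = 1}"

text \<open>Increased by 2, this is the largest weight that one appended element can produce: a new
  maximum has rank \<open>q + a\<close>, which gives \<open>q + 2 + (q + a)\<close>.\<close>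

definition weight :: "(nat \<Rightarrow> 'a::linorder) \<Rightarrow> nat \<Rightarrow> nat" where
  "weight A n = card (suffix_second_minima A n) + 2 * card (suffix_minima A n)"

lemma finite_smaller_right [simp]: "finite (smaller_right A n z)"
  by (simp add: smaller_right_def)

lemma finite_suffix_minima [simp]: "finite (suffix_minima A n)"
  by (simp add: suffix_minima_def)

lemma finite_suffix_second_minima [simp]: "finite (suffix_second_minima A n)"
  by (simp add: suffix_second_minima_def)

section \<open>The weight as a function of the answer table\<close>

lemma mem_suffix_minima_iff:
  fixes A :: "nat \<Rightarrow> 'a::linorder"
  assumes "inj_on A {1..n}" "z \<in> {1..n}"
  shows "z \<in> suffix_minima A n \<longleftrightarrow> RMQ A z n = z"
proof -
  have inj: "inj_on A {z..n}" using assms by (auto elim: inj_on_subset)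
  have "z \<in> suffix_minima A n \<longleftrightarrow> (\<forall>k\<in>{z<..n}. \<not> A k < A z)"
    using assms by (auto simp: suffix_minima_def smaller_right_def)
  also have "\<dots> \<longleftrightarrow> (\<forall>k\<in>{z..n}. k \<noteq> z \<longrightarrow> A z < A k)"
    using inj_onD[OF inj, of _ z] assms by (auto simp: not_less order_le_less)
  also have "\<dots> \<longleftrightarrow> RMQ A z n = z"
    using assms inj by (intro RMQ_eq_iff[symmetric]) auto
  finally show ?thesis .
qed

text \<open>If a single later element is smaller, it is the minimum of \<open>A[z..n]\<close> and
  \<open>z\<close> comes second; conversely, only the minimum lies below the second minimum. The
  condition \<open>z < n\<close> makes \<open>(z, n)\<close> an entry of the answer table.\<close>

lemma mem_suffix_second_minima_iff:
  fixes A :: "nat \<Rightarrow> 'a::linorder"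
  assumes "inj_on A {1..n}" "z \<in> {1..n}"
  shows "z \<in> suffix_second_minima A n \<longleftrightarrow> z < n \<and> R2M A z n = z"
proof
  assume "z \<in> suffix_second_minima A n"
  then obtain m where m: "smaller_right A n z = {m}"
    by (auto simp: suffix_second_minima_def card_1_singleton_iff)
  then have "m \<in> smaller_right A n z" by simp
  then have mz: "m \<in> {z<..n}" "A m < A z" by (simp_all add: smaller_right_def)
  have inj: "inj_on A {z..n}" using assms by (auto elim: inj_on_subset)
  have gt: "A z < A y" if "y \<in> {z..n} - {m}" "y \<noteq> z" for y
  proof -
    have "y \<notin> smaller_right A n z" using m that by simp
    then have "\<not> A y < A z" using that by (simp add: smaller_right_def)
    moreover have "A y \<noteq> A z" using inj_onD[OF inj, of y z] that mz by auto
    ultimately show ?thesis by auto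
  qed
  have "A m < A y" if "y \<in> {z..n}" "y \<noteq> m" for y
    using mz gt[of y] that by (cases "y = z") auto
  then have "RMQ A z n = m"
    using mz by (subst RMQ_eq_iff[OF inj]) auto
  then have "R2M A z n = z"
    unfolding R2M_def using mz gt inj by (subst arg_min_on_eq_iff) (auto simp: inj_on_diff)
  with mz show "z < n \<and> R2M A z n = z" by auto
next
  assume z: "z < n \<and> R2M A z n = z"
  define m where "m = RMQ A z n"
  have inj: "inj_on A {z..n}" using assms by (auto elim: inj_on_subset)
  have m: "m \<in> {z..n}" using z RMQ_in[of z n A] by (simp add: m_def)
  have zm: "z \<in> {z..n} - {m}" using R2M_in[of z n A] z by (simp add: m_def)
  have lt: "A m < A z" using RMQ_eq_iff[OF inj m] zm by (simp add: m_def)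
  have gt: "A z < A y" if "y \<in> {z..n} - {m}" "y \<noteq> z" for y
    using arg_min_on_eq_iff[of "{z..n} - {m}" A z] zm inj z that
    by (simp add: R2M_def m_def inj_on_diff)
  have "k = m" if "k \<in> smaller_right A n z" for k
    using gt[of k] that by (cases "k = m") (auto simp: smaller_right_def)
  moreover have "m \<in> smaller_right A n z"
    using lt m zm by (simp add: smaller_right_def)
  ultimately have "smaller_right A n z = {m}" by blast
  then show "z \<in> suffix_second_minima A n" using assms by (simp add: suffix_second_minima_def)
qed

lemma suffix_minima_cong:
  fixes A B :: "nat \<Rightarrow> 'a::linorder"
  assumes "inj_on A {1..n}" "inj_on B {1..n}" "answers R2M n A = answers R2M n B"
  shows "suffix_minima A n = suffix_minima B n"
proof -
  have "RMQ A z n = RMQ B z n" if "z \<in> {1..n}" for z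
  proof (rule R2M_determines_RMQ)
    have "{z..n} \<subseteq> {1..n}" using that by auto
    then show "inj_on A {z..n}" "inj_on B {z..n}" using assms(1,2) by (blast intro: inj_on_subset)+
    show "R2M A k l = R2M B k l" if "z \<le> k" "k < l" "l \<le> n" for k l
      using assms(3) \<open>z \<in> {1..n}\<close> that by (simp add: answers_eq_iff)
  qed (use that in simp)
  then have "z \<in> suffix_minima A n \<longleftrightarrow> z \<in> suffix_minima B n" if "z \<in> {1..n}" for z
    using mem_suffix_minima_iff assms that by metis
  then show ?thesis by (auto simp: suffix_minima_def)
qed

lemma suffix_second_minima_cong:
  fixes A B :: "nat \<Rightarrow> 'a::linorder"
  assumes "inj_on A {1..n}" "inj_on B {1..n}" "answers R2M n A = answers R2M n B"
  shows "suffix_second_minima A n = suffix_second_minima B n"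
proof -
  have "z \<in> suffix_second_minima A n \<longleftrightarrow> z \<in> suffix_second_minima B n" if "z \<in> {1..n}" for z
    using mem_suffix_second_minima_iff[OF assms(1) that]
      mem_suffix_second_minima_iff[OF assms(2) that] assms(3) that
    by (auto simp: answers_eq_iff)
  then show ?thesis by (auto simp: suffix_second_minima_def)
qed

lemma weight_cong:
  fixes A B :: "nat \<Rightarrow> 'a::linorder"
  assumes "inj_on A {1..n}" "inj_on B {1..n}" "answers R2M n A = answers R2M n B"
  shows "weight A n = weight B n"
  using suffix_minima_cong[OF assms] suffix_second_minima_cong[OF assms] by (simp add: weight_def)

section \<open>Effect of an appended element on the weight\<close>

lemma smaller_right_append:
  assumes "z \<le> n"
  shows "smaller_right (A(Suc n := x)) (Suc n) z =
    (if x < A z then insert (Suc n) (smaller_right A n z) else smaller_right A n z)"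
proof -
  have "{z<..Suc n} = insert (Suc n) {z<..n}" using assms by auto
  then show ?thesis using assms by (auto simp: smaller_right_def)
qed

text \<open>An old position gains one smaller later element exactly if its value exceeds
  \<open>x\<close>. Let \<open>s\<close> suffix minima and \<open>t\<close> suffix second minima lie
  below \<open>x\<close>. Afterwards there are \<open>s + 1\<close> suffix minima, the new position
  included, and \<open>t + (q - s)\<close> second minima, since minima above \<open>x\<close> become
  second minima. The weight is thus
  \<open>t + (q - s) + 2 * (s + 1) = q + 2 + (s + t)\<close>.\<close>

lemma weight_append:
  fixes A :: "nat \<Rightarrow> 'a::linorder"
  assumes x: "x \<notin> A ` {1..n}"
  shows "weight (A(Suc n := x)) (Suc n) = card (suffix_minima A n) + 2 +
    card {z \<in> suffix_minima A n \<union> suffix_second_minima A n. A z < x}"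
proof -
  let ?A = "A(Suc n := x)" and ?Q = "suffix_minima A n" and ?S = "suffix_second_minima A n"
  have card: "card (smaller_right ?A (Suc n) z) =
      (if x < A z then Suc (card (smaller_right A n z)) else card (smaller_right A n z))"
    if "z \<le> n" for z
  proof -
    have "Suc n \<notin> smaller_right A n z" by (simp add: smaller_right_def)
    then show ?thesis unfolding smaller_right_append[OF that] by simp
  qed
  have new: "smaller_right ?A (Suc n) (Suc n) = {}" by (auto simp: smaller_right_def)
  have ne: "A z \<noteq> x" if "z \<in> {1..n}" for z using x that by auto
  have split: "{1..Suc n} = insert (Suc n) {1..n}" by auto
  have "z \<in> suffix_minima ?A (Suc n) \<longleftrightarrow> z \<in> insert (Suc n) {z \<in> ?Q. A z < x}" for z
    using card[of z] ne[of z] new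
    by (cases "z \<in> {1..n}") (auto simp: suffix_minima_def split simp del: card_0_eq card_eq_0_iff)
  then have "suffix_minima ?A (Suc n) = insert (Suc n) {z \<in> ?Q. A z < x}" by blast
  then have Q: "card (suffix_minima ?A (Suc n)) = Suc (card {z \<in> ?Q. A z < x})"
    by (simp add: suffix_minima_def)
  have "z \<in> suffix_second_minima ?A (Suc n) \<longleftrightarrow>
      z \<in> {z \<in> ?S. A z < x} \<union> {z \<in> ?Q. \<not> A z < x}" for z
    using card[of z] ne[of z] new
    by (cases "z \<in> {1..n}") (auto simp: suffix_minima_def suffix_second_minima_def split le_Suc_eq simp del: card_0_eq card_eq_0_iff)
  then have "suffix_second_minima ?A (Suc n) = {z \<in> ?S. A z < x} \<union> {z \<in> ?Q. \<not> A z < x}"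
    by blast
  moreover have disj: "?Q \<inter> ?S = {}" by (auto simp: suffix_minima_def suffix_second_minima_def)
  ultimately have S: "card (suffix_second_minima ?A (Suc n)) =
      card {z \<in> ?S. A z < x} + card {z \<in> ?Q. \<not> A z < x}"
    by (auto intro!: card_Un_disjoint)
  have "card ?Q = card ({z \<in> ?Q. A z < x} \<union> {z \<in> ?Q. \<not> A z < x})"
    by (rule arg_cong[of _ _ card]) auto
  also have "\<dots> = card {z \<in> ?Q. A z < x} + card {z \<in> ?Q. \<not> A z < x}"
    by (intro card_Un_disjoint) auto
  finally have 1: "card ?Q = card {z \<in> ?Q. A z < x} + card {z \<in> ?Q. \<not> A z < x}" .
  have "{z \<in> ?Q \<union> ?S. A z < x} = {z \<in> ?Q. A z < x} \<union> {z \<in> ?S. A z < x}" by auto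
  then have "card {z \<in> ?Q \<union> ?S. A z < x} = card {z \<in> ?Q. A z < x} + card {z \<in> ?S. A z < x}"
    using disj by (simp, intro card_Un_disjoint) auto
  with Q S 1 show ?thesis by (simp add: weight_def)
qed

text \<open>By \<open>weight_append\<close> the required rank among the values on \<open>Z\<close>
  is \<open>v - (q + 2)\<close>. It is at most \<open>card Z = q + a\<close>, so a fresh real of
  that rank exists.\<close>

lemma ex_append_with_weight:
  fixes A :: "nat \<Rightarrow> real"
  assumes A: "inj_on A {1..n}" and "v \<in> {card (suffix_minima A n) + 2..weight A n + 2}"
  shows "\<exists>x. inj_on (A(Suc n := x)) {1..Suc n} \<and> weight (A(Suc n := x)) (Suc n) = v"
proof -
  define Z where "Z = suffix_minima A n \<union> suffix_second_minima A n"
  define q where "q = card (suffix_minima A n)"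
  have v: "q + 2 \<le> v" "v \<le> card (suffix_second_minima A n) + 2 * q + 2"
    using assms(2) by (simp_all add: q_def weight_def)
  have Z: "Z \<subseteq> {1..n}" by (auto simp: Z_def suffix_minima_def suffix_second_minima_def)
  have cZ: "card Z = q + card (suffix_second_minima A n)"
    unfolding Z_def q_def
    by (intro card_Un_disjoint) (auto simp: suffix_minima_def suffix_second_minima_def)
  have inj: "inj_on A Z" using A Z by (rule inj_on_subset)
  have "finite (A ` Z)" using finite_subset[OF Z] by simp
  moreover have "v - (q + 2) \<le> card (A ` Z)"
    unfolding card_image[OF inj] cZ using v by linarith
  ultimately obtain x where x: "x \<notin> A ` {1..n}" "rank (A ` Z) x = v - (q + 2)"
    using ex_real_of_rank[of "A ` Z" "A ` {1..n}" "v - (q + 2)"] by auto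
  have "{t \<in> A ` Z. t < x} = A ` {z \<in> Z. A z < x}" by auto
  moreover have "inj_on A {z \<in> Z. A z < x}"
    using inj by (rule inj_on_subset) blast
  ultimately have "rank (A ` Z) x = card {z \<in> Z. A z < x}"
    unfolding rank_def by (simp only: card_image)
  then have "weight (A(Suc n := x)) (Suc n) = v"
    using weight_append[OF x(1)] x(2) v(1) by (simp flip: Z_def q_def)
  moreover have "inj_on (A(Suc n := x)) {1..Suc n}"
  proof -
    have "inj_on (A(Suc n := x)) {1..n}" using A x(1) by (rule inj_on_fun_updI)
    moreover have "(A(Suc n := x)) ` {1..n} = A ` {1..n}" by (rule image_cong) auto
    moreover have "{1..Suc n} = insert (Suc n) {1..n}" "{1..n} - {Suc n} = {1..n}" by auto
    ultimately show ?thesis using x(1) by (simp only: inj_on_insert fun_upd_same simp_thms)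
  qed
  ultimately show ?thesis by (intro exI[of _ x] conjI)
qed

section \<open>The growth rate\<close>

text \<open>Restriction maps each table for length \<open>n + 1\<close> to its parent for length
  \<open>n\<close>. The children of a class with parameters \<open>q\<close> and \<open>w\<close>
  realise all weights in \<open>{q+2..w+2}\<close>, so \<open>step\<close> bounds the potential of
  the children from below by \<mu> times that of the parent. \<open>W\<close> reads the weight off a
  table.\<close>

lemma potential_step:
  fixes F :: "nat \<Rightarrow> real" and \<mu> :: real
  assumes n: "n \<ge> 1" and F: "\<And>v. F v \<ge> 0"
    and step: "\<And>q w. 1 \<le> q \<Longrightarrow> 2 * q \<le> w \<Longrightarrow> \<mu> * F w \<le> (\<Sum>v=q+2..w+2. F v)"
    and W: "\<And>m A. inj_on A {1..m} \<Longrightarrow> W m (answers R2M m A) = weight (A :: nat \<Rightarrow> real) m"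
  shows "\<mu> * (\<Sum>k \<in> answers R2M n ` {A :: nat \<Rightarrow> real. inj_on A {1..n}}. F (W n k))
    \<le> (\<Sum>k \<in> answers R2M (Suc n) ` {A :: nat \<Rightarrow> real. inj_on A {1..Suc n}}. F (W (Suc n) k))"
proof -
  define K where "K m = answers R2M m ` {A :: nat \<Rightarrow> real. inj_on A {1..m}}" for m
  define \<rho> where "\<rho> k = restrict k {(i, j). 1 \<le> i \<and> i < j \<and> j \<le> n}" for k :: "nat \<times> nat \<Rightarrow> nat"
  have fin: "finite (K m)" for m unfolding K_def by (rule finite_answers_R2M)
  have \<rho>: "\<rho> (answers R2M (Suc n) A) = answers R2M n A" for A :: "nat \<Rightarrow> real"
    unfolding \<rho>_def by (rule answers_restrict) simp
  have \<rho>K: "\<rho> ` K (Suc n) \<subseteq> K n"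
  proof
    fix k assume "k \<in> \<rho> ` K (Suc n)"
    then obtain A :: "nat \<Rightarrow> real" where A: "inj_on A {1..Suc n}" "k = answers R2M n A"
      unfolding K_def using \<rho> by blast
    have "inj_on A {1..n}" using A(1) by (rule inj_on_subset) simp
    with A(2) show "k \<in> K n" unfolding K_def by blast
  qed
  have fibre: "\<mu> * F (W n k) \<le> (\<Sum>k' \<in> {k' \<in> K (Suc n). \<rho> k' = k}. F (W (Suc n) k'))"
    if k: "k \<in> K n" for k
  proof -
    obtain A :: "nat \<Rightarrow> real" where A: "inj_on A {1..n}" "k = answers R2M n A"
      using k by (auto simp: K_def)
    let ?q = "card (suffix_minima A n)" and ?I = "{k' \<in> K (Suc n). \<rho> k' = k}"
    \<comment> \<open>The last position is always a suffix minimum, which supplies the premise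
      \<open>1 \<le> q\<close> of \<open>step\<close>.\<close>
    have "n \<in> suffix_minima A n" using n by (simp add: suffix_minima_def smaller_right_def)
    then have q: "1 \<le> ?q" by (metis card_gt_0_iff empty_iff finite_suffix_minima less_eq_Suc_le One_nat_def)
    have sub: "{?q + 2..weight A n + 2} \<subseteq> W (Suc n) ` ?I"
    proof
      fix v assume "v \<in> {?q + 2..weight A n + 2}"
      then obtain x where x: "inj_on (A(Suc n := x)) {1..Suc n}" "weight (A(Suc n := x)) (Suc n) = v"
        using ex_append_with_weight A by blast
      let ?B = "A(Suc n := x)"
      have "R2M ?B i j = R2M A i j" if "1 \<le> i" "i < j" "j \<le> n" for i j
      proof (rule R2M_cong_order)
        have sub: "{i..j} \<subseteq> {1..n}" using that by auto
        show "inj_on A {i..j}" using A(1) sub by (rule inj_on_subset)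
        show "inj_on ?B {i..j}" using x(1) by (rule inj_on_subset) (use sub in auto)
      qed (use that in auto)
      then have "answers R2M n ?B = k" by (simp add: A(2) answers_eq_iff)
      then have "answers R2M (Suc n) ?B \<in> ?I" using x(1) by (auto simp: K_def \<rho>)
      moreover have "W (Suc n) (answers R2M (Suc n) ?B) = v" using W[OF x(1)] x(2) by simp
      ultimately show "v \<in> W (Suc n) ` ?I" by blast
    qed
    have "\<mu> * F (W n k) = \<mu> * F (weight A n)" using W A by simp
    also have "\<dots> \<le> (\<Sum>v=?q+2..weight A n+2. F v)"
      using q by (intro step) (auto simp: weight_def)
    \<comment> \<open>Further weights, and several children of equal weight, can only increase the
      sum because \<open>F\<close> is nonnegative.\<close>
    also have "\<dots> \<le> sum F (W (Suc n) ` ?I)"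
      using sub fin F by (intro sum_mono2) auto
    also have "\<dots> \<le> (\<Sum>k' \<in> ?I. F (W (Suc n) k'))"
      using sum_image_le[of ?I F "W (Suc n)"] fin F by (simp add: o_def)
    finally show ?thesis .
  qed
  have "\<mu> * (\<Sum>k \<in> K n. F (W n k)) \<le> (\<Sum>k \<in> K n. \<Sum>k' \<in> {k' \<in> K (Suc n). \<rho> k' = k}. F (W (Suc n) k'))"
    unfolding sum_distrib_left using fibre by (rule sum_mono)
  also have "\<dots> = (\<Sum>k' \<in> K (Suc n). F (W (Suc n) k'))"
    using fin \<rho>K by (rule sum.group[OF _ fin])
  finally show ?thesis unfolding K_def .
qed

text \<open>The increasing array is the seed of the growth argument: it realises a weight at which
  the potential is positive.\<close>

lemma weight_of_nat: "weight real n = 2 * n"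
proof -
  have "smaller_right real n z = {}" for z by (auto simp: smaller_right_def)
  then have "suffix_minima real n = {1..n}" "suffix_second_minima real n = {}"
    by (auto simp: suffix_minima_def suffix_second_minima_def)
  then show ?thesis by (simp add: weight_def)
qed

text \<open>The total potential \<open>P\<close> is at most \<open>M\<close> times the number of
  classes, is positive at \<open>n0\<close> by the increasing array, and grows at least by the
  factor \<mu> from there on.\<close>

lemma card_answers_R2M_growth:
  fixes F :: "nat \<Rightarrow> real" and \<mu> :: real
  assumes \<mu>: "\<mu> \<ge> 1" and F: "\<And>v. 0 \<le> F v" "\<And>v. F v \<le> M"
    and step: "\<And>q w. 1 \<le> q \<Longrightarrow> 2 * q \<le> w \<Longrightarrow> \<mu> * F w \<le> (\<Sum>v=q+2..w+2. F v)"
    and pos: "n0 \<ge> 1" "F (2 * n0) > 0"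
  shows "\<exists>c>0. \<forall>n. c * \<mu> ^ n \<le> real (card (answers R2M n ` {A :: nat \<Rightarrow> real. inj_on A {1..n}}))"
proof -
  define K where "K m = answers R2M m ` {A :: nat \<Rightarrow> real. inj_on A {1..m}}" for m
  \<comment> \<open>The choice of representative is harmless by \<open>weight_cong\<close>.\<close>
  define W where "W m k = weight (SOME A :: nat \<Rightarrow> real. inj_on A {1..m} \<and> answers R2M m A = k) m" for m k
  have W: "W m (answers R2M m A) = weight A m" if "inj_on A {1..m}" for m and A :: "nat \<Rightarrow> real"
  proof -
    let ?B = "SOME B :: nat \<Rightarrow> real. inj_on B {1..m} \<and> answers R2M m B = answers R2M m A"
    have "inj_on ?B {1..m} \<and> answers R2M m ?B = answers R2M m A"
      by (rule someI[of _ A]) (use that in simp)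
    then show ?thesis unfolding W_def using that by (intro weight_cong) auto
  qed
  define P where "P m = (\<Sum>k \<in> K m. F (W m k))" for m
  have fin: "finite (K m)" for m unfolding K_def by (rule finite_answers_R2M)
  have realK: "answers R2M m real \<in> K m" for m by (auto simp: K_def)
  have M: "M > 0" using pos F(2)[of "2 * n0"] by linarith
  have "P m \<le> (\<Sum>k \<in> K m. M)" for m unfolding P_def using F by (intro sum_mono)
  then have card: "P m \<le> M * real (card (K m))" for m by (simp add: mult.commute)
  have "F (W n0 (answers R2M n0 real)) \<le> P n0"
    unfolding P_def using fin realK F by (intro member_le_sum) auto
  then have P0: "P n0 > 0" using pos by (simp add: W weight_of_nat)
  have Pn: "\<mu> ^ m * P n0 \<le> P (n0 + m)" for m
  proof (induction m)
    case (Suc m)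
    have "\<mu> ^ Suc m * P n0 \<le> \<mu> * P (n0 + m)"
      using mult_left_mono[OF Suc, of \<mu>] \<mu> by (simp add: mult.assoc)
    also have "\<dots> \<le> P (n0 + Suc m)"
      using potential_step[of "n0 + m" F \<mu> W] pos F step W by (simp add: P_def K_def)
    finally show ?case .
  qed simp
  \<comment> \<open>The first bound serves \<open>n > n0\<close>; the second makes
    \<open>c * \<mu> ^ n\<close> at most 1 for \<open>n \<le> n0\<close>, where one class
    suffices.\<close>
  define c where "c = min (P n0 / M / \<mu> ^ n0) (1 / \<mu> ^ n0)"
  have "c > 0" using P0 M \<mu> by (simp add: c_def)
  moreover have "c * \<mu> ^ n \<le> real (card (K n))" for n
  proof (cases "n \<le> n0")
    case True
    have "c * \<mu> ^ n \<le> 1 / \<mu> ^ n0 * \<mu> ^ n0"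
      using True \<mu> by (intro mult_mono power_increasing) (auto simp: c_def)
    also have "\<dots> = 1" using \<mu> by simp
    finally have "c * \<mu> ^ n \<le> 1" .
    moreover have "card (K n) > 0" using realK[of n] fin[of n] by (auto simp: card_gt_0_iff)
    ultimately show ?thesis by linarith
  next
    case False
    then obtain m where m: "n = n0 + m" by (metis nat_le_iff_add nat_le_linear)
    have "c * \<mu> ^ n \<le> P n0 / M / \<mu> ^ n0 * \<mu> ^ n"
      using \<mu> by (intro mult_right_mono) (auto simp: c_def)
    also have "\<dots> = \<mu> ^ m * P n0 / M" using \<mu> by (simp add: m power_add)
    also have "\<dots> \<le> real (card (K n))"
      using Pn[of m] card[of n] M by (simp add: m divide_le_eq mult.commute)
    finally show ?thesis .
  qed
  ultimately show ?thesis unfolding K_def by (intro exI[of _ c]) simp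
qed

section \<open>Linear recurrence and potential function\<close>

text \<open>Each term is \<mu> times a difference of consecutive values, so the sum
  telescopes.\<close>

lemma recurrence_sum:
  fixes f :: "nat \<Rightarrow> real"
  assumes "\<And>k. f (k + 3) = \<mu> * (f (k + 1) - f k)"
  shows "(\<Sum>v=p+3..p+3+d. f v) = \<mu> * (f (p + d + 1) - f p)"
proof (induction d)
  case 0
  then show ?case using assms[of p] by simp
next
  case (Suc d)
  have "{p+3..p+3+Suc d} = insert (p + Suc d + 3) {p+3..p+3+d}" by auto
  then have "(\<Sum>v=p+3..p+3+Suc d. f v) = (\<Sum>v=p+3..p+3+d. f v) + f (p + Suc d + 3)"
    by simp
  then show ?case using Suc assms[of "p + Suc d"] by (simp add: algebra_simps)
qed

text \<open>The factor \<mu> is the one for which \<open>z ^ 3 = \<mu> * (z - 1)\<close> has a root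
  of argument \<open>pi / L\<close>. Powers of this root solve the recurrence and change sign with
  half-period \<open>L\<close>; \<open>F\<close> keeps the positive half-wave between
  \<open>L\<close> and \<open>2 * L\<close>. As \<open>L\<close> grows, \<open>c\<close> tends to 1
  and the factor to \<open>27/4\<close>.\<close>

lemma ex_potential:
  fixes L :: nat
  assumes L: "L \<ge> 4"
  defines "c \<equiv> cos (pi / L)"
  shows "\<exists>F M. (\<forall>v. 0 \<le> F v \<and> F v \<le> M) \<and> (\<forall>v. L < v \<and> v < 2 * L \<longrightarrow> 0 < F v) \<and>
    (\<forall>q w. 1 \<le> q \<and> 2 * q \<le> w \<longrightarrow> (4 * c\<^sup>2 - 1) ^ 3 / (4 * c\<^sup>2) * F w \<le> (\<Sum>v=q+2..w+2. F v :: real))"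
proof -
  define \<theta> where "\<theta> = pi / L"
  have L0: "real L > 0" using L by simp
  have \<theta>: "0 < \<theta>" "L * \<theta> = pi" using L0 by (auto simp: \<theta>_def)
  \<comment> \<open>From \<open>L \<ge> 4\<close> the angle is below \<open>pi / 3\<close>, which
    makes \<open>4 * c\<^sup>2 - 1\<close>, and with it \<rho> and \<mu>, positive.\<close>
  have c: "c > 1 / 2"
  proof -
    have "\<theta> < pi / 3" unfolding \<theta>_def using L by (intro divide_strict_left_mono) auto
    then have "cos (pi / 3) < cos \<theta>" using \<theta> by (intro cos_monotone_0_pi) auto
    then show ?thesis by (simp add: c_def \<theta>_def cos_60)
  qed
  then have c2: "4 * c\<^sup>2 - 1 > 0"
    using power_strict_mono[of "1/2" c 2] by (simp add: power2_eq_square)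
  \<comment> \<open>Both constants come from inserting a root of modulus \<rho> and argument
    \<theta>. The imaginary part gives \<mu>1, as
    \<open>sin (3 * \<theta>) = (4 * c\<^sup>2 - 1) * sin \<theta>\<close>; the real part then gives
    \<mu>2.\<close>
  define \<mu> \<rho> where "\<mu> = (4 * c\<^sup>2 - 1) ^ 3 / (4 * c\<^sup>2)" and "\<rho> = (4 * c\<^sup>2 - 1) / (2 * c)"
  have \<rho>: "\<rho> > 0" and \<mu>: "\<mu> > 0" using c c2 by (auto simp: \<rho>_def \<mu>_def)
  have \<mu>1: "\<mu> = \<rho>\<^sup>2 * (4 * c\<^sup>2 - 1)" and \<mu>2: "\<mu> = 2 * c * \<rho> ^ 3"
    using c by (simp_all add: \<mu>_def \<rho>_def field_simps power2_eq_square power3_eq_cube)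
  define \<sigma> where "\<sigma> = Complex (\<rho> * cos \<theta>) (\<rho> * sin \<theta>)"
  have \<sigma>_cis: "\<sigma> = of_real \<rho> * cis \<theta>" by (simp add: \<sigma>_def complex_eq_iff)
  have \<sigma>3: "\<sigma> ^ 3 = of_real \<mu> * (\<sigma> - 1)"
  proof -
    have s: "sin \<theta> * sin \<theta> = 1 - c * c"
      using sin_squared_eq[of \<theta>] by (simp add: c_def \<theta>_def power2_eq_square)
    have co: "cos \<theta> = c" by (simp add: c_def \<theta>_def)
    have "Re (\<sigma> ^ 3) = \<rho> ^ 3 * (c * c * c - 3 * c * (sin \<theta> * sin \<theta>))"
      by (simp add: \<sigma>_def power3_eq_cube co algebra_simps)
    also have "\<dots> = \<rho> * c * (\<rho>\<^sup>2 * (4 * c\<^sup>2 - 1)) - 2 * c * \<rho> ^ 3"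
      unfolding s by (simp add: power2_eq_square power3_eq_cube algebra_simps)
    also have "\<dots> = \<mu> * (\<rho> * c - 1)"
      unfolding \<mu>1[symmetric] \<mu>2[symmetric] by (simp add: algebra_simps)
    finally have re: "Re (\<sigma> ^ 3) = Re (of_real \<mu> * (\<sigma> - 1))" by (simp add: \<sigma>_def co)
    have "Im (\<sigma> ^ 3) = \<rho> ^ 3 * sin \<theta> * (3 * c * c - sin \<theta> * sin \<theta>)"
      by (simp add: \<sigma>_def power3_eq_cube co algebra_simps)
    also have "\<dots> = \<rho>\<^sup>2 * (4 * c\<^sup>2 - 1) * (\<rho> * sin \<theta>)"
      unfolding s by (simp add: power2_eq_square power3_eq_cube algebra_simps)
    finally have im: "Im (\<sigma> ^ 3) = Im (of_real \<mu> * (\<sigma> - 1))" by (simp add: \<sigma>_def \<mu>1)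
    from re im show ?thesis by (rule complex_eqI)
  qed
  define f where "f k = - Im (\<sigma> ^ k)" for k
  have f: "f k = - (\<rho> ^ k * sin (k * \<theta>))" for k
    by (simp add: f_def \<sigma>_cis power_mult_distrib DeMoivre flip: of_real_power)
  have rec: "f (k + 3) = \<mu> * (f (k + 1) - f k)" for k
  proof -
    have "\<sigma> ^ (k + 3) = of_real \<mu> * (\<sigma> ^ (k + 1) - \<sigma> ^ k)"
      unfolding power_add[of \<sigma> k] \<sigma>3 by (simp add: algebra_simps)
    then have "Im (\<sigma> ^ (k + 3)) = \<mu> * (Im (\<sigma> ^ (k + 1)) - Im (\<sigma> ^ k))" by simp
    then show ?thesis unfolding f_def by (simp only: right_diff_distrib mult_minus_right)
  qed
  have f_le: "f k \<le> 0" if "k \<le> L" for k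
  proof -
    have "k * \<theta> \<le> pi" using that \<theta> by (metis mult_right_mono of_nat_mono less_imp_le)
    then show ?thesis using \<theta> \<rho> by (simp add: f sin_ge_zero)
  qed
  have shift: "sin (real (m + L) * \<theta>) = - sin (m * \<theta>)" for m
    using \<theta> by (simp add: distrib_right)
  have f_pos: "f k > 0" if "L < k" "k < 2 * L" for k
  proof -
    define m where "m = k - L"
    have m: "k = m + L" "0 < m" "m < L" using that by (auto simp: m_def)
    have "m * \<theta> < pi" using m \<theta> by (metis mult_strict_right_mono of_nat_less_iff)
    then have "sin (m * \<theta>) > 0" using m \<theta> by (intro sin_gt_zero) auto
    then show ?thesis unfolding f m(1) shift using \<rho> by simp
  qed
  \<comment> \<open>The sum to be bounded runs up to \<open>w + 2\<close> and may pass
    \<open>2 * L\<close>; there \<open>f\<close> is again nonpositive, so truncation to 0 still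
    dominates it.\<close>
  have f_le2: "f k \<le> 0" if "2 * L \<le> k" "k \<le> 3 * L" for k
  proof -
    define m where "m = k - 2 * L"
    have m: "k = (m + L) + L" "m \<le> L" using that by (auto simp: m_def)
    have "0 \<le> sin (m * \<theta>)"
      using f_le[OF m(2)] zero_less_power[OF \<rho>, of m] by (auto simp: f zero_le_mult_iff)
    then show ?thesis unfolding f m(1) shift using \<rho> by simp
  qed
  define F where "F v = (if L < v \<and> v < 2 * L then f v else 0)" for v
  have F0: "0 \<le> F v" for v using f_pos by (simp add: F_def less_imp_le)
  have Ff: "f v \<le> F v" if "v \<le> 3 * L" for v
    using that f_le[of v] f_le2[of v] by (auto simp: F_def)
  have FM: "F v \<le> (\<Sum>k<2*L. \<bar>f k\<bar>)" for v
  proof (cases "L < v \<and> v < 2 * L")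
    case True
    then have "\<bar>f v\<bar> \<le> (\<Sum>k<2*L. \<bar>f k\<bar>)" by (intro member_le_sum) auto
    then show ?thesis using True by (simp add: F_def)
  next
    case False
    then show ?thesis by (auto simp: F_def intro: sum_nonneg)
  qed
  have step: "\<mu> * F w \<le> (\<Sum>v=q+2..w+2. F v)" if qw: "1 \<le> q" "2 * q \<le> w" for q w
  proof (cases "L < w \<and> w < 2 * L")
    case True
    \<comment> \<open>With these values the range of \<open>recurrence_sum\<close> becomes
      \<open>{q+2..w+2}\<close>. From \<open>2 * q \<le> w < 2 * L\<close> follows
      \<open>p < L\<close>, so the subtracted \<open>f p\<close> is nonpositive and may be
      dropped.\<close>
    define p d where "p = q - 1" and "d = w - q"
    then have p: "q = p + 1" and d: "w = p + d + 1" using qw by auto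
    have "f p \<le> 0" using True qw p by (intro f_le) auto
    then have "\<mu> * F w \<le> \<mu> * (f w - f p)" using True \<mu> by (simp add: F_def)
    also have "\<dots> = (\<Sum>v=q+2..w+2. f v)"
      using recurrence_sum[OF rec, of p d] by (simp add: p d add.commute add.left_commute numeral_eq_Suc)
    also have "\<dots> \<le> (\<Sum>v=q+2..w+2. F v)"
      using True L by (intro sum_mono Ff) auto
    finally show ?thesis .
  next
    case False
    then have "F w = 0" by (auto simp: F_def)
    then show ?thesis by (simp add: F0 sum_nonneg)
  qed
  have "0 < F v" if "L < v" "v < 2 * L" for v using that f_pos by (simp add: F_def)
  with F0 FM step show ?thesis
    unfolding \<mu>_def by (intro exI[of _ F] exI[of _ "\<Sum>k<2*L. \<bar>f k\<bar>"]) simp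
qed

section \<open>Numerical bound and passage to entropy\<close>

lemma card_answers_R2M_ge:
  "\<exists>c>0. \<forall>n. c * 2 powr (8 / 3 * n) \<le> real (card (answers R2M n ` {A :: nat \<Rightarrow> real. inj_on A {1..n}}))"
proof -
  define c where "c = cos (pi / real 100)"
  define \<mu> where "\<mu> = (4 * c\<^sup>2 - 1) ^ 3 / (4 * c\<^sup>2)"
  \<comment> \<open>The crude bound \<open>pi < 4\<close> suffices:
    \<open>c\<^sup>2 \<ge> 1 - 0.04\<^sup>2 = 0.9984\<close>, and \<open>2.99 ^ 3 / 4\<close>
    exceeds 6.6.\<close>
  have "sin (pi / 100) \<le> pi / 100" by (rule sin_x_le_x) simp
  also have "\<dots> \<le> 4 / 100" using pi_less_4 by simp
  finally have "(sin (pi / 100))\<^sup>2 \<le> (4 / 100)\<^sup>2"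
    by (intro power_mono) (auto intro!: sin_ge_zero)
  then have c2: "c\<^sup>2 \<ge> 0.998" using sin_cos_squared_add[of "pi / 100"]
    by (simp add: c_def power2_eq_square)
  have c1: "c\<^sup>2 \<le> 1" by (simp add: c_def cos_squared_eq)
  have "2.99 ^ 3 / 4 \<le> \<mu>"
    unfolding \<mu>_def using c1 c2 by (intro frac_le power_mono) auto
  then have \<mu>: "\<mu> \<ge> 6.6" by (simp add: power3_eq_cube)
  \<comment> \<open>Cubing turns the comparison into \<open>256 \<le> 6.6 ^ 3\<close>.\<close>
  have "(2 powr (8 / 3)) ^ 3 = (2 powr 8 :: real)"
    by (simp add: powr_powr flip: powr_realpow)
  also have "\<dots> \<le> \<mu> ^ 3"
    using power_mono[OF \<mu>, of 3] by (simp add: power3_eq_cube)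
  finally have le: "2 powr (8 / 3) \<le> \<mu>"
    using power_le_imp_le_base[of _ 2 \<mu>] \<mu> by (simp add: numeral_3_eq_3)
  obtain F :: "nat \<Rightarrow> real" and M where F: "\<forall>v. 0 \<le> F v \<and> F v \<le> M" "\<forall>v. 100 < v \<and> v < 2 * 100 \<longrightarrow> 0 < F v"
    "\<forall>q w. 1 \<le> q \<and> 2 * q \<le> w \<longrightarrow> \<mu> * F w \<le> (\<Sum>v=q+2..w+2. F v)"
    using ex_potential[of 100] unfolding \<mu>_def c_def of_nat_numeral by auto
  have "\<exists>d>0. \<forall>n. d * \<mu> ^ n \<le> real (card (answers R2M n ` {A :: nat \<Rightarrow> real. inj_on A {1..n}}))"
  proof (rule card_answers_R2M_growth)
    \<comment> \<open>The increasing array of length 75 has weight 150, inside the window between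
      100 and 200.\<close>
    show "0 < F (2 * 75)" using F(2) by simp
  qed (use F \<mu> in auto)
  then obtain d where d: "d > 0"
    "\<And>n. d * \<mu> ^ n \<le> real (card (answers R2M n ` {A :: nat \<Rightarrow> real. inj_on A {1..n}}))"
    by blast
  have "2 powr (8 / 3 * n) \<le> \<mu> ^ n" for n :: nat
    using power_mono[OF le, of n] by (simp add: powr_powr flip: powr_realpow)
  then have le: "d * 2 powr (8 / 3 * n) \<le> d * \<mu> ^ n" for n :: nat using d(1) by simp
  have "d * 2 powr (8 / 3 * n) \<le> real (card (answers R2M n ` {A :: nat \<Rightarrow> real. inj_on A {1..n}}))"
    for n using le[of n] d(2)[of n] by (rule order_trans)
  with d(1) show ?thesis by (rule_tac exI[of _ d]) simp
qed

lemma effective_entropy_ge: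
  assumes "c > 0" "c * 2 powr x \<le> real (card (X // query_equiv X Q))"
  shows "x + log 2 c \<le> real_of_int (effective_entropy X Q)"
proof -
  have "x + log 2 c = log 2 (c * 2 powr x)" using assms(1) by (simp add: log_mult)
  also have "\<dots> \<le> log 2 (real (card (X // query_equiv X Q)))"
    using assms by (intro log_mono) auto
  also have "\<dots> \<le> real_of_int (effective_entropy X Q)"
    unfolding effective_entropy_def by (rule le_of_int_ceiling)
  finally show ?thesis .
qed

theorem theorem4:
  shows "\<exists>g :: nat \<Rightarrow> real. g \<in> O(\<lambda>n. log 2 (real n)) \<and>
    (\<forall>n \<ge> 1. \<forall>U :: 'a::linorder set. infinite U \<or> n \<le> card U \<longrightarrow>
      real_of_int (effective_entropy (arrays U n) (range_queries R2M n)) \<ge> 2.638 * real n - g n \<and>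
      real_of_int (effective_entropy (arrays U n) (range_queries RT2Q n)) \<ge> 2.638 * real n - g n)"
proof -
  obtain c where c: "c > 0"
    "\<And>n. c * 2 powr (8 / 3 * n) \<le> real (card (answers R2M n ` {A :: nat \<Rightarrow> real. inj_on A {1..n}}))"
    using card_answers_R2M_ge by blast
  have main: "8 / 3 * n + log 2 c \<le> effective_entropy (arrays U n) (range_queries R2M n) \<and>
      8 / 3 * n + log 2 c \<le> effective_entropy (arrays U n) (range_queries RT2Q n)"
    if U: "infinite U \<or> n \<le> card U" for n and U :: "'a set"
  proof -
    \<comment> \<open>Every table of a real array also occurs over \<open>U\<close>, so the count
      over the reals is a lower bound there.\<close>
    have "answers R2M n A \<in> answers R2M n ` arrays U n" if A: "inj_on A {1..n}" for A :: "nat \<Rightarrow> real"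
    proof -
      obtain B where B: "B \<in> arrays U n" "\<And>i j. i \<in> {1..n} \<Longrightarrow> j \<in> {1..n} \<Longrightarrow> B i < B j \<longleftrightarrow> A i < A j"
        using ex_order_isomorphic_array[OF A U] by blast
      have "inj_on B {1..n}" using B(1) by (simp add: arrays_def)
      then have "R2M A i j = R2M B i j" if "1 \<le> i" "i < j" "j \<le> n" for i j
        using A B(2) that by (intro R2M_cong_order) (auto elim: inj_on_subset)
      then have "answers R2M n A = answers R2M n B" by (simp add: answers_eq_iff)
      then show ?thesis using B(1) by blast
    qed
    then have "card (answers R2M n ` {A :: nat \<Rightarrow> real. inj_on A {1..n}}) \<le> card (answers R2M n ` arrays U n)"
      by (intro card_mono finite_answers_R2M) auto
    then have R2M: "c * 2 powr (8 / 3 * n) \<le> real (card (answers R2M n ` arrays U n))"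
      using c(2)[of n] by linarith
    then have "c * 2 powr (8 / 3 * n) \<le> real (card (answers RT2Q n ` arrays U n))"
      using card_answers_R2M_le_RT2Q[of n "arrays U n"] by linarith
    with R2M show ?thesis
      using c(1) by (auto intro!: effective_entropy_ge simp: card_quotient_query_equiv)
  qed
  \<comment> \<open>The error term is a constant; it is dominated by the logarithm because
    \<open>log 2 n \<ge> 1\<close> from \<open>n = 2\<close> on.\<close>
  have "(\<lambda>_. - log 2 c) \<in> O(\<lambda>n. log 2 (real n))"
  proof (rule bigoI)
    show "\<forall>\<^sub>F n in sequentially. norm (- log 2 c) \<le> \<bar>log 2 c\<bar> * norm (log 2 (real n))"
    proof (rule eventually_sequentiallyI[of 2])
      fix n :: nat assume "2 \<le> n"
      then have "1 \<le> log 2 (real n)" by (simp add: le_log_iff)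
      then show "norm (- log 2 c) \<le> \<bar>log 2 c\<bar> * norm (log 2 (real n))"
        by (simp add: mult_le_cancel_left1)
    qed
  qed
  moreover have "2.638 * real n - (- log 2 c) \<le> effective_entropy (arrays U n) (range_queries R2M n) \<and>
      2.638 * real n - (- log 2 c) \<le> effective_entropy (arrays U n) (range_queries RT2Q n)"
    if "infinite U \<or> n \<le> card U" for n and U :: "'a set"
  proof -
    have "2.638 * real n - (- log 2 c) \<le> 8 / 3 * n + log 2 c" by simp
    then show ?thesis using main[OF that] by linarith
  qed
  ultimately show ?thesis by (intro exI[of _ "\<lambda>_. - log 2 c"] conjI allI impI) auto
qed

end
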